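(* Let $n>k\ge 1$ be integers, let $\boldsymbol{X}\in\mathbb{R}^{n\times k}$ have rank $k$, let $\boldsymbol{K}\in\mathbb{R}^{k\times k}$ be symmetric positive semidefinite, and let $\boldsymbol{W}\in\mathbb{R}^{n\times n}$ be a row-standardized spatial weights matrix. Let $\mathcal{P}=\{\rho\in\mathbb{R}\mid \rho\neq 0 \text{ and } |\rho|<1\}$, and for each $\rho\in\mathcal{P}$ let $\boldsymbol{\Omega}(\rho)=(\boldsymbol{I}_n+\rho\boldsymbol{W})(\boldsymbol{I}_n+\rho\boldsymbol{W}^\top)$. Then the following statements are equivalent: (i) $\mathcal{C}\begin{pmatrix}\boldsymbol{\Omega}(\rho)\boldsymbol{X}\\ \boldsymbol{K}\end{pmatrix}=\mathcal{C}\begin{pmatrix}\boldsymbol{X}\\ \boldsymbol{K}\end{pmatrix}$ for all $\rho\in\mathcal{P}$. (ii) There exist two different $\rho_1,\rho_2\in\mathcal{P}$ such that $\mathcal{C}\begin{pmatrix}\boldsymbol{\Omega}(\rho)\boldsymbol{X}\\ \boldsymbol{K}\end{pmatrix}=\mathcal{C}\begin{pmatrix}\boldsymbol{X}\\ \boldsymbol{K}\end{pmatrix}$ for $\rho=\rho_1$ and for $\rho=\rho_2$. (iii) $\mathcal{C}\begin{pmatrix}(\boldsymbol{W}+\boldsymbol{W}^\top)\boldsymbol{X}\\ \boldsymbol{0}\end{pmatrix}\subseteq\mathcal{C}\begin{pmatrix}\boldsymbol{X}\\ \boldsymbol{K}\end{pmatrix}$ and $\mathcal{C}\begin{pmatrix}\boldsymbol{W}\boldsymbol{W}^\top\boldsymbol{X}\\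 \boldsymbol{0}\end{pmatrix}\subseteq\mathcal{C}\begin{pmatrix}\boldsymbol{X}\\ \boldsymbol{K}\end{pmatrix}$.
   Context: $\mathcal{C}(\boldsymbol{A})$ denotes the column space of a real matrix $\boldsymbol{A}$; the zero block $\boldsymbol{0}$ in the stacked matrices is $k\times k$, and $\boldsymbol{I}_n$ is the $n\times n$ identity matrix. A row-standardized spatial weights matrix is a matrix $\boldsymbol{W}=(w_{ij})\in\mathbb{R}^{n\times n}$ (not necessarily symmetric) with $w_{ij}\ge 0$ and $\sum_{j=1}^n w_{ij}=1$ for every $i=1,\dots,n$; for such $\boldsymbol{W}$ the matrix $\boldsymbol{\Omega}(\rho)$ is nonsingular whenever $|\rho|<1$. *)

theory Defs
  imports "HOL-Analysis.Analysis"
begin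

definition col_space :: "real^'c^'r \<Rightarrow> (real^'r) set" where
  "col_space A = span (columns A)"

text \<open>The rows of the stacked matrix are indexed by the disjoint sum of the two row index types,
  so a matrix with \<open>n\<close> rows on top of one with \<open>k\<close> rows has \<open>n + k\<close> rows.\<close>

definition stack :: "real^'c^'a \<Rightarrow> real^'c^'b \<Rightarrow> real^'c^('a + 'b)" where
  "stack A B = (\<chi> i. case i of Inl a \<Rightarrow> A $ a | Inr b \<Rightarrow> B $ b)"

definition sym_pos_semidef :: "real^'a^'a \<Rightarrow> bool" where
  "sym_pos_semidef K \<longleftrightarrow> transpose K = K \<and> (\<forall>x. 0 \<le> x \<bullet> (K *v x))"

definition row_standardized :: "real^'a^'a \<Rightarrow> bool" where
  "row_standardized W \<longleftrightarrow>
     (\<forall>i j. 0 \<le> W $ i $ j) \<and> (\<forall>i. (\<Sum>j\<in>UNIV. W $ i $ j) = 1)"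

definition rho_set :: "real set" where
  "rho_set = {\<rho>. \<rho> \<noteq> 0 \<and> \<bar>\<rho>\<bar> < 1}"

definition Omega :: "real^'n^'n \<Rightarrow> real \<Rightarrow> real^'n^'n" where
  "Omega W \<rho> = (mat 1 + \<rho> *\<^sub>R W) ** (mat 1 + \<rho> *\<^sub>R transpose W)"

end

theory Submission
  imports Defs
begin

text \<open>
  Write \<open>a v\<close> and \<open>b v\<close> for the images of \<open>v\<close> under the matrices \<open>(W + W\<^sup>T) X\<close> and \<open>W W\<^sup>T X\<close>,
  padded with a zero block, and \<open>S\<close> for the column space of \<open>X\<close> stacked on \<open>K\<close>. Since
  \<open>\<Omega>(\<rho>) = I + \<rho> (W + W\<^sup>T) + \<rho>\<^sup>2 W W\<^sup>T\<close>, the matrix \<open>\<Omega>(\<rho>) X\<close> stacked on \<open>K\<close> sends \<open>v\<close> to an element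
  of \<open>S\<close> plus \<open>\<rho> (a v + \<rho> b v)\<close>.

  For \<open>\<bar>\<rho>\<bar> < 1\<close> both stacked matrices have trivial kernel, because \<open>\<Omega>(\<rho>)\<close> is nonsingular and \<open>X\<close> has
  full column rank. Their column spaces therefore have the same dimension, and coincide as soon as
  one contains the other. Hence, for each single \<open>\<rho>\<close> with \<open>0 < \<bar>\<rho>\<bar> < 1\<close>, equality of the two column
  spaces means exactly that the line \<open>a v + \<rho> b v\<close> meets the subspace \<open>S\<close> at this parameter, for every
  \<open>v\<close> (\<open>col_space_stack_Omega_eq_iff\<close>). A line that meets a subspace at two different parameters has
  its direction \<open>b v\<close> and its base point \<open>a v\<close> in it, and then lies in it entirely; this is the
  equivalence of the three conditions.
\<close>

section \<open>Column spaces and stacked matrices\<close>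

lemma col_space_eq_range: "col_space A = range ((*v) A)"
proof
  have "subspace (range ((*v) A))"
    by (intro linear_subspace_image) auto
  moreover have "columns A \<subseteq> range ((*v) A)"
    by (auto simp: columns_def matrix_vector_mult_basis [symmetric])
  ultimately show "col_space A \<subseteq> range ((*v) A)"
    unfolding col_space_def by (rule span_minimal [rotated])
  show "range ((*v) A) \<subseteq> col_space A"
    unfolding col_space_def using matrix_vector_mult_in_columnspace by blast
qed

lemma subspace_col_space: "subspace (col_space A)"
  unfolding col_space_def by (rule subspace_span)

text \<open>The two column spaces have the number of columns as their common dimension.\<close>

lemma col_space_eq_if_subset:
  fixes A B :: "real^'c^'r"
  assumes "inj ((*v) A)" "inj ((*v) B)" "col_space A \<subseteq> col_space B"
  shows "col_space A = col_space B"
proof -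
  have "dim (col_space A) = dim (col_space B)"
    using assms(1,2) unfolding col_space_eq_range
    by (metis full_rank_injective rank_dim_range)
  then show ?thesis
    using assms(3) by (intro subspace_dim_equal subspace_col_space) auto
qed

lemma stack_mult_vector_nth:
  "(stack A B *v v) $ Inl i = (A *v v) $ i"
  "(stack A B *v v) $ Inr j = (B *v v) $ j"
  by (simp_all add: stack_def matrix_vector_mult_def)

lemma inj_stack:
  fixes A :: "real^'c^'a" and B :: "real^'c^'b"
  assumes "inj ((*v) A)"
  shows "inj ((*v) (stack A B))"
proof (rule injI)
  fix x y
  assume eq: "stack A B *v x = stack A B *v y"
  have "A *v x = A *v y"
    unfolding vec_eq_iff by (metis eq stack_mult_vector_nth(1))
  then show "x = y"
    using assms by (simp add: inj_eq)
qed

section \<open>The matrix Omega\<close>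

text \<open>
  If \<open>x = - \<rho> W x\<close>, then an entry of \<open>x\<close> of largest modulus is \<open>- \<rho>\<close> times a convex combination of
  entries of \<open>x\<close>, so its modulus shrinks by the factor \<open>\<bar>\<rho>\<bar> < 1\<close> and has to vanish.
\<close>

lemma invertible_row_standardized_perturbation:
  fixes W :: "real^'n^'n"
  assumes W: "row_standardized W" and \<rho>: "\<bar>\<rho>\<bar> < 1"
  shows "invertible (mat 1 + \<rho> *\<^sub>R W)"
proof -
  have "x = 0" if x: "(mat 1 + \<rho> *\<^sub>R W) *v x = 0" for x
  proof -
    define m where "m = Max (range (\<lambda>i. \<bar>x $ i\<bar>))"
    have le_m: "\<bar>x $ i\<bar> \<le> m" for i
      unfolding m_def by (rule Max_ge) auto
    have "m \<in> range (\<lambda>i. \<bar>x $ i\<bar>)"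
      unfolding m_def by (rule Max_in) auto
    then obtain i where i: "m = \<bar>x $ i\<bar>" by auto
    have "x + \<rho> *\<^sub>R (W *v x) = 0"
      using x by (simp add: matrix_vector_mult_add_rdistrib scaleR_matrix_vector_assoc)
    then have "x $ i + \<rho> * (W *v x) $ i = 0"
      by (metis vector_add_component vector_scaleR_component real_scaleR_def zero_index)
    then have "m = \<bar>\<rho>\<bar> * \<bar>(W *v x) $ i\<bar>"
      unfolding i by (simp add: abs_mult [symmetric] eq_neg_iff_add_eq_0 [symmetric])
    also have "\<bar>(W *v x) $ i\<bar> \<le> (\<Sum>j\<in>UNIV. W $ i $ j * \<bar>x $ j\<bar>)"
      using W unfolding row_standardized_def matrix_vector_mult_def
      by (auto intro!: order.trans [OF sum_abs] sum_mono simp: abs_mult)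
    also have "\<dots> \<le> (\<Sum>j\<in>UNIV. W $ i $ j * m)"
      using W le_m unfolding row_standardized_def by (intro sum_mono mult_left_mono) auto
    also have "\<dots> = m"
      using W unfolding row_standardized_def by (simp add: sum_distrib_right [symmetric])
    finally have "m \<le> \<bar>\<rho>\<bar> * m"
      by (simp add: mult_left_mono)
    then have "(1 - \<bar>\<rho>\<bar>) * m \<le> 0"
      by (simp add: algebra_simps)
    then have "m \<le> 0"
      using \<rho> by (simp add: mult_le_0_iff)
    then show "x = 0"
      using le_m by (simp add: vec_eq_iff) (metis abs_le_zero_iff order.trans)
  qed
  then show ?thesis
    by (simp add: invertible_left_inverse matrix_left_invertible_ker)
qed

lemma invertible_Omega:
  assumes "row_standardized W" "\<bar>\<rho>\<bar> < 1"
  shows "invertible (Omega W \<rho>)"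
proof -
  have "transpose (mat 1 + \<rho> *\<^sub>R W) = mat 1 + \<rho> *\<^sub>R transpose W"
    by (simp add: transpose_def mat_def vec_eq_iff)
  then show ?thesis
    unfolding Omega_def using invertible_row_standardized_perturbation [OF assms]
    by (metis invertible_mult transpose_invertible)
qed

lemma Omega_mult_vector:
  "Omega W \<rho> *v x =
    x + \<rho> *\<^sub>R ((W + transpose W) *v x + \<rho> *\<^sub>R ((W ** transpose W) *v x))"
  unfolding Omega_def matrix_vector_mul_assoc [symmetric]
  by (simp add: matrix_vector_mult_add_rdistrib matrix_vector_right_distrib
      matrix_vector_mult_scaleR scaleR_matrix_vector_assoc [symmetric] algebra_simps
      del: transpose_matrix_vector)

lemma stack_Omega_mult_vector:
  "stack (Omega W \<rho> ** X) K *v v =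
    stack X K *v v + \<rho> *\<^sub>R (stack ((W + transpose W) ** X) 0 *v v
      + \<rho> *\<^sub>R (stack ((W ** transpose W) ** X) 0 *v v))"
  (is "?l = ?r")
proof -
  have "?l $ s = ?r $ s" for s
    by (cases s)
      (simp_all add: stack_mult_vector_nth matrix_vector_mul_assoc [symmetric] Omega_mult_vector
        del: transpose_matrix_vector)
  then show ?thesis
    by (simp add: vec_eq_iff)
qed

section \<open>Equality of the column spaces\<close>

lemma subspace_scaleR_mem_iff:
  assumes "subspace S" "c \<noteq> 0"
  shows "c *\<^sub>R x \<in> S \<longleftrightarrow> x \<in> S"
  using subspace_scale [OF assms(1), of "c *\<^sub>R x" "inverse c"] subspace_scale [OF assms(1), of x c]
    assms(2) by auto

text \<open>
  The summand of \<open>stack_Omega_mult_vector\<close> that involves \<open>K\<close> already lies in the target subspace, and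
  the factor \<open>\<rho> \<noteq> 0\<close> can be divided out; what is left is a condition affine in \<open>\<rho>\<close>.
\<close>

lemma col_space_stack_Omega_eq_iff:
  fixes X :: "real^'k^'n" and K :: "real^'k^'k" and W :: "real^'n^'n"
  assumes X: "rank X = CARD('k)" and W: "row_standardized W" and \<rho>: "\<rho> \<in> rho_set"
  shows "col_space (stack (Omega W \<rho> ** X) K) = col_space (stack X K) \<longleftrightarrow>
    (\<forall>v. stack ((W + transpose W) ** X) (0 :: real^'k^'k) *v v
      + \<rho> *\<^sub>R (stack ((W ** transpose W) ** X) (0 :: real^'k^'k) *v v) \<in> col_space (stack X K))"
    (is "?L = ?S \<longleftrightarrow> (\<forall>v. ?a v + \<rho> *\<^sub>R ?b v \<in> ?S)")
proof -
  have \<rho>0: "\<rho> \<noteq> 0" and \<rho>1: "\<bar>\<rho>\<bar> < 1"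
    using \<rho> by (auto simp: rho_set_def)
  have inj_X: "inj ((*v) X)"
    using X by (simp add: full_rank_injective)
  have "inj ((*v) (Omega W \<rho>))"
    using invertible_Omega [OF W \<rho>1] by (rule inj_matrix_vector_mult)
  then have "inj ((*v) (Omega W \<rho> ** X))"
    using inj_X by (simp add: inj_def matrix_vector_mul_assoc [symmetric])
  then have "?L = ?S \<longleftrightarrow> ?L \<subseteq> ?S"
    using col_space_eq_if_subset inj_stack inj_X by blast
  also have "\<dots> \<longleftrightarrow> (\<forall>v. stack X K *v v + \<rho> *\<^sub>R (?a v + \<rho> *\<^sub>R ?b v) \<in> ?S)"
    unfolding col_space_eq_range [of "stack (Omega W \<rho> ** X) K"]
    by (auto simp: stack_Omega_mult_vector)
  also have "\<dots> \<longleftrightarrow> (\<forall>v. \<rho> *\<^sub>R (?a v + \<rho> *\<^sub>R ?b v) \<in> ?S)"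
  proof -
    have "stack X K *v v \<in> ?S" for v
      by (simp add: col_space_eq_range)
    then show ?thesis
      unfolding col_space_def by (simp add: span_add_eq)
  qed
  also have "\<dots> \<longleftrightarrow> (\<forall>v. ?a v + \<rho> *\<^sub>R ?b v \<in> ?S)"
    using \<rho>0 by (simp add: subspace_scaleR_mem_iff subspace_col_space)
  finally show ?thesis .
qed

lemma subspace_line_two_points:
  fixes a b :: "'a::real_vector"
  assumes S: "subspace S" and "r \<noteq> s" and r: "a + r *\<^sub>R b \<in> S" and s: "a + s *\<^sub>R b \<in> S"
  shows "a \<in> S \<and> b \<in> S"
proof -
  have "(r - s) *\<^sub>R b \<in> S"
    using subspace_diff [OF S r s] by (simp add: algebra_simps)
  then have b: "b \<in> S"
    using \<open>r \<noteq> s\<close> by (simp add: subspace_scaleR_mem_iff [OF S])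
  then have "(a + r *\<^sub>R b) - r *\<^sub>R b \<in> S"
    using S r by (intro subspace_diff subspace_scale)
  with b show ?thesis by simp
qed

theorem theorem3p3:
  fixes X :: "real^'k^'n" and K :: "real^'k^'k" and W :: "real^'n^'n"
  assumes "CARD('k) < CARD('n)"
    and "rank X = CARD('k)"
    and "sym_pos_semidef K"
    and "row_standardized W"
  defines "i \<equiv> (\<forall>\<rho>\<in>rho_set. col_space (stack (Omega W \<rho> ** X) K) = col_space (stack X K))"
  defines "ii \<equiv> (\<exists>\<rho>\<^sub>1\<in>rho_set. \<exists>\<rho>\<^sub>2\<in>rho_set. \<rho>\<^sub>1 \<noteq> \<rho>\<^sub>2 \<and>
              col_space (stack (Omega W \<rho>\<^sub>1 ** X) K) = col_space (stack X K) \<and>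
              col_space (stack (Omega W \<rho>\<^sub>2 ** X) K) = col_space (stack X K))"
  defines "iii \<equiv> (col_space (stack ((W + transpose W) ** X) (0 :: real^'k^'k)) \<subseteq> col_space (stack X K) \<and>
              col_space (stack ((W ** transpose W) ** X) (0 :: real^'k^'k)) \<subseteq> col_space (stack X K))"
  shows "(i \<longleftrightarrow> ii) \<and> (ii \<longleftrightarrow> iii)"
proof -
  let ?S = "col_space (stack X K)"
  let ?a = "\<lambda>v. stack ((W + transpose W) ** X) (0 :: real^'k^'k) *v v"
  let ?b = "\<lambda>v. stack ((W ** transpose W) ** X) (0 :: real^'k^'k) *v v"
  note eq_iff = col_space_stack_Omega_eq_iff [OF assms(2,4)]
  have iii: "iii \<longleftrightarrow> (\<forall>v. ?a v \<in> ?S \<and> ?b v \<in> ?S)"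
    unfolding iii_def col_space_eq_range [of "stack _ 0"] by auto
  have "ii" if "i"
  proof -
    have "1/2 \<in> rho_set" "1/3 \<in> rho_set" "1/2 \<noteq> (1/3 :: real)"
      by (simp_all add: rho_set_def)
    then show ii
      using that unfolding i_def ii_def by blast
  qed
  moreover have "iii" if "ii"
  proof -
    from that obtain r s where rs: "r \<in> rho_set" "s \<in> rho_set" "r \<noteq> s"
      and "col_space (stack (Omega W r ** X) K) = ?S" "col_space (stack (Omega W s ** X) K) = ?S"
      unfolding ii_def by blast
    then have "?a v + r *\<^sub>R ?b v \<in> ?S" "?a v + s *\<^sub>R ?b v \<in> ?S" for v
      by (simp_all add: eq_iff)
    then show iii
      unfolding iii using subspace_line_two_points [OF subspace_col_space rs(3)] by blast
  qed
  moreover have "i" if "iii"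
    unfolding i_def
  proof
    fix \<rho> :: real
    assume \<rho>: "\<rho> \<in> rho_set"
    have "?a v + \<rho> *\<^sub>R ?b v \<in> ?S" for v
      using that unfolding iii by (intro subspace_add subspace_scale subspace_col_space) auto
    then show "col_space (stack (Omega W \<rho> ** X) K) = ?S"
      by (simp add: eq_iff [OF \<rho>])
  qed
  ultimately show ?thesis by blast
qed

end
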